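(* Let $G=(V,E)$ be a graph and let $C\subseteq V$ induce a $5$-cycle in $G$. Then every $X_C=(X_{ij})_{i,j\in C}\in\mathrm{COL}(G_C)$ satisfies $$\sum_{\substack{i,j\in C\\ i<j}}X_{ij}\le2 .$$
   Context: Graphs are finite, simple and undirected, with vertex set $V=\{1,\dots,n\}$ (so the sum over $i<j$ runs over each unordered pair of distinct vertices once). For $C\subseteq V$, $G_C$ is the subgraph of $G$ induced by $C$. A cycle is a sequence of distinct vertices $i_1,\dots,i_k$ ($k\ge3$) such that consecutive vertices are adjacent and $i_k$ is adjacent to $i_1$; its length is $k$, and it may have chords (further edges between its vertices). A set $C$ induces a $5$-cycle in $G$ if $C$ is the vertex set of a cycle of length $5$ in $G$. For a graph $H$, a coloring matrix of $H$ is a matrix $\sum_{p=1}^{\ell}s_ps_p^\top$, where $s_1,\dots,s_\ell\in\{0,1\}^{V(H)}$ are the incidence vectors of the (nonempty) classes of a partition of $V(H)$ into stable sets of $H$ (for some $\ell$); $\mathrm{COL}(H)$ is the convex hull of all coloring matrices of $H$. *)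

theory Defs
  imports "HOL-Analysis.Analysis" "HOL-Library.Disjoint_Sets"
begin

(* A graph is a pair (vertex set, edge set); edges are two-element sets of vertices.
   The vertex set may be any subset of the ambient type, so that induced subgraphs
   of a graph live in the same type. *)
type_synonym 'v graph = "'v set \<times> 'v set set"

abbreviation verts :: "'v graph \<Rightarrow> 'v set" where "verts G \<equiv> fst G"
abbreviation edges :: "'v graph \<Rightarrow> 'v set set" where "edges G \<equiv> snd G"

definition simple_graph :: "'v graph \<Rightarrow> bool" where
  "simple_graph G \<longleftrightarrow> finite (verts G) \<and> (\<forall>e\<in>edges G. e \<subseteq> verts G \<and> card e = 2)"

definition adjacent :: "'v graph \<Rightarrow> 'v \<Rightarrow> 'v \<Rightarrow> bool" where
  "adjacent G u v \<longleftrightarrow> {u, v} \<in> edges G"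

definition induced_subgraph :: "'v graph \<Rightarrow> 'v set \<Rightarrow> 'v graph" where
  "induced_subgraph G C = (C, {e \<in> edges G. e \<subseteq> C})"

(* Chords are allowed. *)
definition is_cycle :: "'v graph \<Rightarrow> 'v list \<Rightarrow> bool" where
  "is_cycle G vs \<longleftrightarrow> 3 \<le> length vs \<and> distinct vs \<and> set vs \<subseteq> verts G \<and>
     successively (adjacent G) vs \<and> adjacent G (last vs) (hd vs)"

definition induces_cycle :: "'v graph \<Rightarrow> nat \<Rightarrow> 'v set \<Rightarrow> bool" where
  "induces_cycle G k C \<longleftrightarrow> (\<exists>vs. is_cycle G vs \<and> length vs = k \<and> set vs = C)"

definition stable_set :: "'v graph \<Rightarrow> 'v set \<Rightarrow> bool" where
  "stable_set G S \<longleftrightarrow> S \<subseteq> verts G \<and> (\<forall>u\<in>S. \<forall>v\<in>S. \<not> adjacent G u v)"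

definition incidence_vec :: "'n set \<Rightarrow> real ^ 'n" where
  "incidence_vec S = (\<chi> i. indicator S i)"

(* the matrix s s^T *)
definition outer_square :: "real ^ 'n \<Rightarrow> real ^ 'n ^ 'n" where
  "outer_square s = (\<chi> i j. s $ i * s $ j)"

(* Matrices indexed by verts H are represented as matrices over the whole index type that
   are zero outside verts H \<times> verts H: every class S below is contained in verts H. *)
definition coloring_matrices :: "('n::finite) graph \<Rightarrow> (real ^ 'n ^ 'n) set" where
  "coloring_matrices H =
     {(\<Sum>S\<in>P. outer_square (incidence_vec S)) | P.
        partition_on (verts H) P \<and> (\<forall>S\<in>P. stable_set H S)}"

definition COL :: "('n::finite) graph \<Rightarrow> (real ^ 'n ^ 'n) set" where
  "COL H = convex hull (coloring_matrices H)"

end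

theory Submission
  imports Defs
begin

text \<open>
  The sum of the entries above the diagonal is a linear function of \<open>X\<close>, so it suffices to
  bound it on the coloring matrices, the generators of the convex hull. For the coloring matrix
  of a partition \<open>P\<close> of \<open>C\<close> into stable sets the sum counts the pairs of
  vertices that share a class. By \<open>stable_set_in_cycle_card\<close> a stable set contains at most half
  of the vertices of a cycle, hence at most two of the five; chords only make stability
  more restrictive. A class of size at most two contains at most half as many pairs as vertices
  (\<open>card_pairs_le_half\<close>), so the five vertices of \<open>C\<close> give at most \<open>5 / 2\<close> pairs altogether.
  The number of pairs is an integer, so it is at most \<open>2\<close>.
\<close>

lemma cycle_adjacent_Suc_mod:
  assumes "is_cycle G vs" and "i < length vs"
  shows "adjacent G (vs ! i) (vs ! (Suc i mod length vs))"
proof (cases "Suc i = length vs")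
  case True
  then have "vs \<noteq> []" "i = length vs - 1" by auto
  then show ?thesis
    using assms(1) True by (auto simp: is_cycle_def last_conv_nth hd_conv_nth)
next
  case False
  then show ?thesis
    using assms by (simp add: is_cycle_def successively_conv_nth)
qed

text \<open>Moving one step along the cycle is injective and sends a stable set to a disjoint set.\<close>

lemma stable_set_in_cycle_card:
  assumes cycle: "is_cycle G vs" and "S \<subseteq> set vs"
    and stable: "\<And>u v. u \<in> S \<Longrightarrow> v \<in> S \<Longrightarrow> \<not> adjacent G u v"
  shows "2 * card S \<le> length vs"
proof -
  let ?k = "length vs"
  let ?next = "\<lambda>i. Suc i mod ?k"
  define I where "I = {i. i < ?k \<and> vs ! i \<in> S}"
  have "distinct vs" and "0 < ?k"
    using cycle by (auto simp: is_cycle_def)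
  have I: "I \<subseteq> {..<?k}" "finite I"
    by (auto simp: I_def)
  have "S = (!) vs ` I"
    using \<open>S \<subseteq> set vs\<close> by (fastforce simp: I_def in_set_conv_nth)
  moreover have "inj_on ((!) vs) I"
    using \<open>distinct vs\<close> I by (auto intro!: inj_on_nth)
  ultimately have "card S = card I"
    by (simp add: card_image)
  have "inj_on ?next I"
    by (auto intro!: inj_onI simp: I_def mod_Suc split: if_splits)
  then have card_next: "card (?next ` I) = card I"
    by (rule card_image)
  have "I \<inter> ?next ` I = {}"
    using cycle_adjacent_Suc_mod[OF cycle] stable by (auto simp: I_def)
  then have "2 * card I = card (I \<union> ?next ` I)"
    using I card_next by (simp add: card_Un_disjoint)
  also have "\<dots> \<le> card {..<?k}"
    using I \<open>0 < ?k\<close> by (intro card_mono) auto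
  finally show ?thesis
    using \<open>card S = card I\<close> by simp
qed

lemma card_pairs_le_half:
  fixes S :: "'a::linorder set"
  assumes "finite S" and "card S \<le> 2"
  shows "2 * card {(i, j). i \<in> S \<and> j \<in> S \<and> i < j} \<le> card S"
proof -
  consider "S = {}" | a where "S = {a}" | a b where "a < b" "S = {a, b}"
  proof -
    from assms consider "card S = 0" | "card S = 1" | "card S = 2" by linarith
    then show thesis
    proof cases
      case 3
      then obtain a b where "S = {a, b}" "a \<noteq> b" by (auto simp: card_2_iff)
      then show thesis using that(3)[of a b] that(3)[of b a] by (auto simp: neq_iff insert_commute)
    qed (use assms that in \<open>auto simp: card_1_singleton_iff\<close>)
  qed
  then show ?thesis
  proof cases
    case (2 a)
    then have "{(i, j). i \<in> S \<and> j \<in> S \<and> i < j} = {}" by auto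
    then show ?thesis by (simp only: card.empty)
  next
    case (3 a b)
    then have "{(i, j). i \<in> S \<and> j \<in> S \<and> i < j} = {(a, b)}" by auto
    then show ?thesis using 3 by simp
  qed simp
qed

lemma sum_upper_entries_outer_square:
  fixes S C :: "('n::{finite,linorder}) set"
  assumes "S \<subseteq> C"
  shows "(\<Sum>(i, j)\<in>{(i, j). i \<in> C \<and> j \<in> C \<and> i < j}. outer_square (incidence_vec S) $ i $ j)
    = real (card {(i, j). i \<in> S \<and> j \<in> S \<and> i < j})"
proof -
  have "(\<Sum>(i, j)\<in>{(i, j). i \<in> C \<and> j \<in> C \<and> i < j}. outer_square (incidence_vec S) $ i $ j)
      = (\<Sum>(i, j)\<in>{(i, j). i \<in> S \<and> j \<in> S \<and> i < j}. 1)"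
    using assms
    by (intro sum.mono_neutral_cong_right)
      (auto simp: outer_square_def incidence_vec_def indicator_def split: if_splits)
  then show ?thesis
    by (simp add: case_prod_unfold)
qed

lemma linear_sum_entries:
  "linear (\<lambda>X :: real ^ 'n ^ 'm. \<Sum>(i, j)\<in>T. X $ i $ j)"
  by (rule linearI) (simp_all add: case_prod_unfold sum.distrib sum_distrib_left)

text \<open>The integrality step takes place here: the bound \<open>2\<close>, rather than \<open>5 / 2\<close>, holds because
  the sum of the entries of a coloring matrix counts pairs.\<close>

lemma coloring_matrix_pairs_le_2:
  fixes H :: "('n::{finite,linorder}) graph"
  assumes "card (verts H) = 5"
    and small: "\<And>S. stable_set H S \<Longrightarrow> card S \<le> 2"
    and "X \<in> coloring_matrices H"
  shows "(\<Sum>(i, j)\<in>{(i, j). i \<in> verts H \<and> j \<in> verts H \<and> i < j}. X $ i $ j) \<le> 2"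
proof -
  let ?T = "{(i, j). i \<in> verts H \<and> j \<in> verts H \<and> i < j}"
  let ?pairs = "\<lambda>S::'n set. card {(i, j). i \<in> S \<and> j \<in> S \<and> i < j}"
  from assms(3) obtain P where X: "X = (\<Sum>S\<in>P. outer_square (incidence_vec S))"
    and P: "partition_on (verts H) P" and stable: "\<And>S. S \<in> P \<Longrightarrow> stable_set H S"
    by (auto simp: coloring_matrices_def)
  have "(\<Sum>(i, j)\<in>?T. X $ i $ j)
      = (\<Sum>S\<in>P. \<Sum>(i, j)\<in>?T. outer_square (incidence_vec S) $ i $ j)"
    unfolding X by (rule linear_sum[OF linear_sum_entries])
  also have "\<dots> = (\<Sum>S\<in>P. real (?pairs S))"
    using stable by (intro sum.cong refl sum_upper_entries_outer_square) (auto simp: stable_set_def)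
  also have "\<dots> = real (\<Sum>S\<in>P. ?pairs S)"
    by simp
  finally have count: "(\<Sum>(i, j)\<in>?T. X $ i $ j) = real (\<Sum>S\<in>P. ?pairs S)" .
  have "2 * (\<Sum>S\<in>P. ?pairs S) \<le> (\<Sum>S\<in>P. card S)"
    unfolding sum_distrib_left
    by (intro sum_mono card_pairs_le_half small stable) auto
  also have "\<dots> = card (\<Union>P)"
    using P by (intro card_Union_disjoint[symmetric]) (auto simp: partition_on_def disjoint_def pairwise_def disjnt_def)
  also have "\<dots> = 5"
    using P assms(1) by (simp add: partition_on_def)
  finally have "(\<Sum>S\<in>P. ?pairs S) \<le> 2"
    by linarith
  then show ?thesis
    unfolding count by linarith
qed

theorem lemma19:
  fixes G :: "('n::{finite,linorder}) graph"
    and C :: "'n set"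
    and X :: "real ^ ('n::{finite,linorder}) ^ ('n::{finite,linorder})"
  assumes "simple_graph G"
    and "C \<subseteq> verts G"
    and "induces_cycle G 5 C"
    and "X \<in> COL (induced_subgraph G C)"
  shows "(\<Sum>(i, j)\<in>{(i, j). i \<in> C \<and> j \<in> C \<and> i < j}. X $ i $ j) \<le> 2"
proof -
  let ?H = "induced_subgraph G C"
  let ?f = "\<lambda>X :: real ^ ('n::{finite,linorder}) ^ ('n::{finite,linorder}).
    \<Sum>(i, j)\<in>{(i, j). i \<in> C \<and> j \<in> C \<and> i < j}. X $ i $ j"
  from assms(3) obtain vs where vs: "is_cycle G vs" "length vs = 5" "set vs = C"
    by (auto simp: induces_cycle_def)
  have H: "verts ?H = C"
    by (simp add: induced_subgraph_def)
  have card_C: "card C = 5"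
    using vs distinct_card by (fastforce simp: is_cycle_def)
  have small: "card S \<le> 2" if "stable_set ?H S" for S
  proof -
    have "S \<subseteq> set vs" "\<And>u v. u \<in> S \<Longrightarrow> v \<in> S \<Longrightarrow> \<not> adjacent G u v"
      using that vs(3) by (auto simp: stable_set_def induced_subgraph_def adjacent_def)
    from stable_set_in_cycle_card[OF vs(1) this] show ?thesis
      using vs(2) by linarith
  qed
  have "coloring_matrices ?H \<subseteq> ?f -` {..2}"
    using coloring_matrix_pairs_le_2[of ?H] card_C small by (auto simp: H)
  moreover have "convex (?f -` {..2})"
    by (intro convex_linear_vimage linear_sum_entries) simp
  ultimately have "COL ?H \<subseteq> ?f -` {..2}"
    unfolding COL_def by (rule hull_minimal)
  then show ?thesis
    using assms(4) by auto
qed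

end
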